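(* Let $\rho\in\mathbb{R}$ be the regularization order. The integral kernel associated with the LLE is $$K_{\mathrm{LLE}}(x,y)=\big[1-\mathbf{T}_{\iota(x)}^\top(\iota(y)-\iota(x))\big]\chi_{B_\epsilon^{\mathbb{R}^p}(\iota(x))\cap\iota(M)}(\iota(y)),\qquad x,y\in M,$$ where $$\mathbf{T}_{\iota(x)}=\mathcal{I}_{\epsilon^{d+\rho}}(C_x)\,\mathbb{E}\big[(X-\iota(x))\chi_{B_\epsilon^{\mathbb{R}^p}(\iota(x))}(X)\big]\in\mathbb{R}^p;$$ that is, for every $f\in C(\iota(M))$ and $x\in M$, $$\mathbb{E}\big[f(X)(1-\mathbf{T}_{\iota(x)}^\top(X-\iota(x)))\chi_{B_\epsilon^{\mathbb{R}^p}(\iota(x))}(X)\big]=\int_M K_{\mathrm{LLE}}(x,y)f(\iota(y))P(y)\,dV(y).$$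
   Context: $(M,g)$ is a $d$-dimensional compact smooth Riemannian manifold without boundary with volume form $dV$, isometrically embedded by $\iota:M\hookrightarrow\mathbb{R}^p$. $X$ is a $p$-dimensional random vector with range supported on $\iota(M)$, whose law is absolutely continuous with respect to the induced Riemannian volume on $\iota(M)$, with density $P\in C^5(\iota(M))$ satisfying $0<P_m\le P\le P_M<\infty$; $P(y)$ means $P(\iota(y))$. $\epsilon>0$; $B^{\mathbb{R}^p}_\epsilon(z)$ is the closed Euclidean ball and $\chi$ denotes an indicator function. $C_x=\mathbb{E}[(X-\iota(x))(X-\iota(x))^\top\chi_{B^{\mathbb{R}^p}_\epsilon(\iota(x))}(X)]$ is the local covariance matrix. For a symmetric positive semidefinite $A\in\mathbb{R}^{p\times p}$ of rank $r$ with eigendecomposition $A=U\Lambda U^\top$ (eigenvalues in decreasing order) and $c>0$, $\mathcal{I}_c(A)=U I_{p,r}(\Lambda+cI_{p\times p})^{-1}I_{p,r}U^\top$, where $I_{p,r}$ is diagonal with first $r$ diagonal entries $1$ and the others $0$. The (unnormalized) asymptotic LLE operator is $f\mapsto \mathbb{E}[f(X)(1-\mathbf{T}_{\iota(x)}^\top(X-\iota(x)))\chi_{B_\epsilon^{\mathbb{R}^p}(\iota(x))}(X)]$, and "the integral kernel associated with the LLE" is its kernel with respect to $P\,dV$. *)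

theory Defs
  imports "HOL-Analysis.Analysis" "HOL-Probability.Probability"
begin

type_synonym 'p rvec = "(real, 'p) vec"
type_synonym 'p rmat = "((real, 'p) vec, 'p) vec"


section \<open>Functions of class \<open>C\<^sup>k\<close> on open subsets of a Euclidean space\<close>

primrec Ck_on :: "nat \<Rightarrow> ('a::euclidean_space \<Rightarrow> 'b::real_normed_vector) \<Rightarrow> 'a set \<Rightarrow> bool" where
  "Ck_on 0 f S \<longleftrightarrow> continuous_on S f"
| "Ck_on (Suc k) f S \<longleftrightarrow>
     f differentiable_on S \<and> (\<forall>b\<in>Basis. Ck_on k (\<lambda>x. frechet_derivative f (at x) b) S)"

definition smooth_on :: "('a::euclidean_space \<Rightarrow> 'b::real_normed_vector) \<Rightarrow> 'a set \<Rightarrow> bool" where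
  "smooth_on f S \<longleftrightarrow> (\<forall>k. Ck_on k f S)"


section \<open>Riemannian manifolds\<close>

text \<open>
  A manifold is a topology together with a smooth atlas. A chart is a pair of a domain \<open>D\<close> and a
  map \<open>\<phi>\<close>; only the restriction of \<open>\<phi>\<close> to \<open>D\<close> matters. The atlas need not be maximal.
  All chart images are open in \<open>\<real>\<^sup>d\<close>, so there is no boundary.
\<close>

type_synonym ('m, 'd) chart = "'m set \<times> ('m \<Rightarrow> real^'d)"

definition chart_inv :: "('m, 'd::finite) chart \<Rightarrow> real^'d \<Rightarrow> 'm" where
  "chart_inv c = inv_into (fst c) (snd c)"

definition is_chart :: "'m topology \<Rightarrow> ('m, 'd::finite) chart \<Rightarrow> bool" where
  "is_chart T c \<longleftrightarrow> openin T (fst c) \<and> open (snd c ` fst c) \<and>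
     homeomorphic_map (subtopology T (fst c)) (top_of_set (snd c ` fst c)) (snd c)"

definition smooth_manifold :: "'m topology \<Rightarrow> ('m, 'd::finite) chart set \<Rightarrow> bool" where
  "smooth_manifold T \<A> \<longleftrightarrow>
     Hausdorff_space T \<and> second_countable T \<and>
     (\<forall>c\<in>\<A>. is_chart T c) \<and> (\<Union>c\<in>\<A>. fst c) = topspace T \<and>
     (\<forall>c\<in>\<A>. \<forall>c'\<in>\<A>. smooth_on (snd c' \<circ> chart_inv c) (snd c ` (fst c \<inter> fst c')))"

text \<open>
  A Riemannian metric is given by its Gram matrices \<open>g c x\<close> at the points \<open>x\<close> of each chart \<open>c\<close>,
  with respect to the coordinate vector fields of \<open>c\<close>.
\<close>

definition riemannian_metric ::
  "('m, 'd::finite) chart set \<Rightarrow> (('m, 'd) chart \<Rightarrow> 'm \<Rightarrow> real^'d^'d) \<Rightarrow> bool" where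
  "riemannian_metric \<A> g \<longleftrightarrow>
     (\<forall>c\<in>\<A>. smooth_on (g c \<circ> chart_inv c) (snd c ` fst c)) \<and>
     (\<forall>c\<in>\<A>. \<forall>x\<in>fst c. transpose (g c x) = g c x \<and> (\<forall>v. v \<noteq> 0 \<longrightarrow> 0 < v \<bullet> (g c x *v v))) \<and>
     (\<forall>c\<in>\<A>. \<forall>c'\<in>\<A>. \<forall>x\<in>fst c \<inter> fst c'. \<forall>u v.
        (let J = frechet_derivative (snd c' \<circ> chart_inv c) (at (snd c x))
         in u \<bullet> (g c x *v v) = J u \<bullet> (g c' x *v J v)))"

text \<open>
  The Riemannian volume measure is the Borel measure with density \<open>\<surd>(det g)\<close> with respect to
  Lebesgue measure in every chart; as countably many charts cover the manifold, this
  determines it uniquely.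
\<close>

definition riemannian_volume ::
  "'m topology \<Rightarrow> ('m, 'd::finite) chart set \<Rightarrow> (('m, 'd) chart \<Rightarrow> 'm \<Rightarrow> real^'d^'d) \<Rightarrow>
    'm measure \<Rightarrow> bool" where
  "riemannian_volume T \<A> g V \<longleftrightarrow>
     sets V = sigma_sets (topspace T) {U. openin T U} \<and>
     (\<forall>c\<in>\<A>. \<forall>B\<in>sets V. B \<subseteq> fst c \<longrightarrow>
        emeasure V B = (\<integral>\<^sup>+y\<in>snd c ` B. ennreal (sqrt (det (g c (chart_inv c y)))) \<partial>lborel))"

definition isometric_embedding ::
  "'m topology \<Rightarrow> ('m, 'd::finite) chart set \<Rightarrow> (('m, 'd) chart \<Rightarrow> 'm \<Rightarrow> real^'d^'d) \<Rightarrow>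
    ('m \<Rightarrow> ('p::finite) rvec) \<Rightarrow> bool" where
  "isometric_embedding T \<A> g \<iota> \<longleftrightarrow>
     embedding_map T euclidean \<iota> \<and>
     (\<forall>c\<in>\<A>. smooth_on (\<iota> \<circ> chart_inv c) (snd c ` fst c)) \<and>
     (\<forall>c\<in>\<A>. \<forall>x\<in>fst c. \<forall>u v.
        (let J = frechet_derivative (\<iota> \<circ> chart_inv c) (at (snd c x))
         in J u \<bullet> J v = u \<bullet> (g c x *v v)))"

text \<open>\<open>F \<in> C\<^sup>k(\<iota>(M))\<close>, where \<open>\<iota>(M)\<close> carries the charts transported from \<open>M\<close>; the values of \<open>F\<close>
  outside \<open>\<iota>(M)\<close> play no role.\<close>

definition Ck_on_image ::
  "nat \<Rightarrow> ('m, 'd::finite) chart set \<Rightarrow> ('m \<Rightarrow> ('p::finite) rvec) \<Rightarrow> ('p rvec \<Rightarrow> real) \<Rightarrow> bool" where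
  "Ck_on_image k \<A> \<iota> F \<longleftrightarrow> (\<forall>c\<in>\<A>. Ck_on k (F \<circ> \<iota> \<circ> chart_inv c) (snd c ` fst c))"

text \<open>The measure induced on \<open>\<iota>(M)\<close>, with the Borel sets of \<open>\<iota>(M)\<close> as measurable sets.\<close>

definition induced_volume :: "'m measure \<Rightarrow> ('m \<Rightarrow> ('p::finite) rvec) \<Rightarrow> 'p rvec measure" where
  "induced_volume V \<iota> = distr V (restrict_space borel (\<iota> ` space V)) \<iota>"


section \<open>The regularized pseudo-inverse\<close>

text \<open>
  The index type \<open>'p\<close> is linearly ordered, which gives a meaning to ``decreasing order'' and to
  ``the first \<open>r\<close> diagonal entries''. The columns of \<open>U\<close> are the eigenvectors.
\<close>

definition diag_mat :: "('p::finite) rvec \<Rightarrow> 'p rmat" where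
  "diag_mat l = (\<chi> i j. if i = j then l $ i else 0)"

definition eigendecomposition ::
  "('p::{finite,linorder}) rmat \<Rightarrow> 'p rmat \<Rightarrow> 'p rvec \<Rightarrow> bool" where
  "eigendecomposition A U l \<longleftrightarrow>
     orthogonal_matrix U \<and> A = U ** diag_mat l ** transpose U \<and> (\<forall>i j. i \<le> j \<longrightarrow> l $ j \<le> l $ i)"

definition trunc_id :: "nat \<Rightarrow> ('p::{finite,linorder}) rmat" where
  "trunc_id r = diag_mat (\<chi> i. if card {k. k < i} < r then 1 else 0)"

definition reg_inverse_wrt ::
  "real \<Rightarrow> ('p::{finite,linorder}) rmat \<Rightarrow> 'p rmat \<Rightarrow> 'p rvec \<Rightarrow> 'p rmat" where
  "reg_inverse_wrt c A U l =
     U ** trunc_id (rank A) ** matrix_inv (diag_mat l + c *\<^sub>R mat 1) ** trunc_id (rank A) ** transpose U"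

definition reg_inverse :: "real \<Rightarrow> ('p::{finite,linorder}) rmat \<Rightarrow> 'p rmat" where
  "reg_inverse c A =
     (let (U, l) = SOME (U, l). eigendecomposition A U l in reg_inverse_wrt c A U l)"

text \<open>An eigendecomposition of a symmetric matrix exists by the spectral theorem; lemma \<open>reg_inverse_eq\<close>
  below shows that for positive semidefinite \<open>A\<close> its choice is immaterial.\<close>

lemma diag_mat_mult:
  "diag_mat a ** diag_mat b = diag_mat (\<chi> i. a $ i * b $ i)"
  by (simp add: vec_eq_iff diag_mat_def matrix_matrix_mult_def if_distrib[where f="\<lambda>x. x * _"]
      cong: if_cong)

lemma diag_mat_mult_vec: "diag_mat a *v x = (\<chi> i. a $ i * x $ i)"
  by (simp add: vec_eq_iff diag_mat_def matrix_vector_mult_def if_distrib[where f="\<lambda>x. x * _"]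
      cong: if_cong)

lemma rank_eigendecomposition:
  assumes "eigendecomposition A U l"
  shows "rank A = card {i. l $ i \<noteq> 0}"
proof -
  have U: "U ** transpose U = mat 1" "transpose U ** U = mat 1" and
    A: "A = U ** diag_mat l ** transpose U"
    using assms by (auto simp: eigendecomposition_def orthogonal_matrix_def)
  have U1: "transpose U *v (U *v x) = x" "U *v (transpose U *v x) = x" for x
    by (simp_all only: matrix_vector_mul_assoc U matrix_vector_mul_lid)
  have "range (\<lambda>x. A *v x) = (\<lambda>x. U *v x) ` range (\<lambda>x. diag_mat l *v x)"
  proof safe
    fix x show "A *v x \<in> (\<lambda>x. U *v x) ` range (\<lambda>x. diag_mat l *v x)"
      by (auto simp: A simp flip: matrix_vector_mul_assoc)
  next
    fix x
    have "U *v (diag_mat l *v x) = A *v (U *v x)"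
      unfolding A by (simp add: U1 del: transpose_matrix_vector flip: matrix_vector_mul_assoc)
    then show "U *v (diag_mat l *v x) \<in> range (\<lambda>x. A *v x)" by simp
  qed
  moreover have "inj (\<lambda>x. U *v x)" by (metis U1(1) injI)
  ultimately have "rank A = dim (range (\<lambda>x. diag_mat l *v x))"
    unfolding rank_dim_range by (simp add: dim_image_eq inj_on_subset)
  also have "range (\<lambda>x. diag_mat l *v x) = {x. \<forall>i. i \<notin> {i. l $ i \<noteq> 0} \<longrightarrow> x $ i = 0}"
  proof safe
    fix x :: "'a rvec" assume x: "\<forall>i. i \<notin> {i. l $ i \<noteq> 0} \<longrightarrow> x $ i = 0"
    then have "x = diag_mat l *v (\<chi> i. x $ i / l $ i)"
      by (auto simp: diag_mat_mult_vec vec_eq_iff)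
    then show "x \<in> range (\<lambda>x. diag_mat l *v x)" by (rule range_eqI)
  qed (auto simp: diag_mat_mult_vec)
  also have "dim \<dots> = card {i. l $ i \<noteq> 0}" by (simp only: dim_substandard_cart flip: dim_vec_eq)
  finally show ?thesis .
qed

lemma eigenvalues_nonneg:
  assumes "eigendecomposition A U l" and "\<And>v. 0 \<le> v \<bullet> (A *v v)"
  shows "0 \<le> l $ i"
proof -
  have U: "transpose U ** U = mat 1" and A: "A = U ** diag_mat l ** transpose U"
    using assms by (auto simp: eigendecomposition_def orthogonal_matrix_def)
  let ?e = "axis i (1::real)"
  have "A *v (U *v ?e) = U *v (diag_mat l *v ?e)"
    by (simp add: A matrix_vector_mul_assoc U flip: matrix_mul_assoc)
  then have "(U *v ?e) \<bullet> (A *v (U *v ?e)) = (transpose U *v (U *v ?e)) \<bullet> (diag_mat l *v ?e)"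
    by (simp add: dot_lmul_matrix)
  also have "\<dots> = l $ i"
    by (simp only: matrix_vector_mul_assoc U matrix_vector_mul_lid)
      (simp add: diag_mat_mult_vec inner_axis')
  finally show ?thesis using assms(2) by metis
qed

lemma reg_inverse_wrt_eq:
  assumes e: "eigendecomposition A U l" and psd: "\<And>v. 0 \<le> v \<bullet> (A *v v)" and "c > 0"
  shows "reg_inverse_wrt c A U l =
    U ** diag_mat (\<chi> i. if l $ i = 0 then 0 else 1 / (l $ i + c)) ** transpose U"
proof -
  have pos: "0 < l $ i + c" for i using eigenvalues_nonneg[OF e psd, of i] \<open>c > 0\<close> by simp
  have dec: "l $ j \<le> l $ i" if "i \<le> j" for i j using e that by (auto simp: eigendecomposition_def)
  have "card {k. k < i} < card {i. l $ i \<noteq> 0} \<longleftrightarrow> l $ i \<noteq> 0" for i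
  proof
    assume "l $ i \<noteq> 0"
    then have "l $ k \<noteq> 0" if "k \<le> i" for k
      using dec[OF that] eigenvalues_nonneg[OF e psd, of i] by linarith
    then have "{k. k < i} \<subset> {i. l $ i \<noteq> 0}" using \<open>l $ i \<noteq> 0\<close> by auto
    then show "card {k. k < i} < card {i. l $ i \<noteq> 0}"
      by (rule psubset_card_mono[OF finite])
  next
    assume *: "card {k. k < i} < card {i. l $ i \<noteq> 0}"
    show "l $ i \<noteq> 0"
    proof
      assume "l $ i = 0"
      then have "l $ k = 0" if "i \<le> k" for k
        using dec[OF that] eigenvalues_nonneg[OF e psd, of k] by linarith
      then have "{i. l $ i \<noteq> 0} \<subseteq> {k. k < i}" by (auto simp flip: not_le)
      then have "card {i. l $ i \<noteq> 0} \<le> card {k. k < i}" by (rule card_mono[OF finite])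
      then show False using * by simp
    qed
  qed
  then have t: "trunc_id (rank A) = diag_mat (\<chi> i. if l $ i \<noteq> 0 then 1 else 0)"
    by (simp add: trunc_id_def rank_eigendecomposition[OF e])
  let ?D = "diag_mat l + c *\<^sub>R mat 1" and ?E = "diag_mat (\<chi> i. 1 / (l $ i + c))"
  have D: "?D = diag_mat (\<chi> i. l $ i + c)" by (simp add: vec_eq_iff diag_mat_def mat_def)
  have DE: "?D ** ?E = mat 1 \<and> ?E ** ?D = mat 1"
    using pos by (simp_all add: D diag_mat_mult less_imp_neq[THEN not_sym])
      (simp_all add: diag_mat_def mat_def vec_eq_iff)
  then have "?D ** matrix_inv ?D = mat 1 \<and> matrix_inv ?D ** ?D = mat 1"
    unfolding matrix_inv_def by (rule someI)
  with DE have "matrix_inv ?D = ?E" by (metis matrix_mul_assoc matrix_mul_lid matrix_mul_rid)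
  moreover have tEt: "trunc_id (rank A) ** (?E ** (trunc_id (rank A) ** B)) =
      diag_mat (\<chi> i. if l $ i = 0 then 0 else 1 / (l $ i + c)) ** B" for B
    unfolding t matrix_mul_assoc diag_mat_mult by (rule arg_cong[where f = "\<lambda>a. diag_mat a ** B"]) (auto simp: vec_eq_iff)
  ultimately show ?thesis
    by (simp only: reg_inverse_wrt_def tEt flip: matrix_mul_assoc)
qed

lemma reg_inverse_eq:
  assumes e: "eigendecomposition A U l" and psd: "\<And>v. 0 \<le> v \<bullet> (A *v v)" and "c > 0"
  shows "reg_inverse c A = reg_inverse_wrt c A U l"
proof -
  obtain U' l' where c: "(SOME (U, l). eigendecomposition A U l) = (U', l')" by fastforce
  have e': "eigendecomposition A U' l'"
    using someI[of "\<lambda>(U, l). eigendecomposition A U l" "(U, l)"] e c by simp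
  define f where "f t = (if t = 0 then 0 else 1 / (t + c))" for t
  define W where "W = transpose U' ** U"
  have U: "U ** transpose U = mat 1" "transpose U ** U = mat 1" and
    A: "A = U ** diag_mat l ** transpose U"
    using e by (auto simp: eigendecomposition_def orthogonal_matrix_def)
  have U': "U' ** transpose U' = mat 1" "transpose U' ** U' = mat 1" and
    A': "A = U' ** diag_mat l' ** transpose U'"
    using e' by (auto simp: eigendecomposition_def orthogonal_matrix_def)
  have [simp]: "(M ** diag_mat a) $ i $ j = M $ i $ j * a $ j" for M :: "'a rmat" and a i j
    by (simp add: diag_mat_def matrix_matrix_mult_def if_distrib cong: if_cong)
  have [simp]: "(diag_mat a ** M) $ i $ j = a $ i * M $ i $ j" for M :: "'a rmat" and a i j
    by (simp add: diag_mat_def matrix_matrix_mult_def if_distrib[where f="\<lambda>x. x * _"] cong: if_cong)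
  have "W ** diag_mat l = transpose U' ** A ** U"
    unfolding W_def A by (metis U(2) matrix_mul_assoc matrix_mul_rid)
  also have "\<dots> = diag_mat l' ** W"
    unfolding W_def A' by (metis U'(2) matrix_mul_assoc matrix_mul_lid)
  finally have W: "W $ i $ j * l $ j = l' $ i * W $ i $ j" for i j
    by (simp add: vec_eq_iff)
  have "W $ i $ j * f (l $ j) = f (l' $ i) * W $ i $ j" for i j
    using W[of i j] by (cases "W $ i $ j = 0") auto
  then have "W ** diag_mat (\<chi> i. f (l $ i)) = diag_mat (\<chi> i. f (l' $ i)) ** W"
    by (simp add: vec_eq_iff)
  then have "U' ** (W ** diag_mat (\<chi> i. f (l $ i))) ** transpose U =
      U' ** (diag_mat (\<chi> i. f (l' $ i)) ** W) ** transpose U" by simp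
  then have "U ** diag_mat (\<chi> i. f (l $ i)) ** transpose U =
      U' ** diag_mat (\<chi> i. f (l' $ i)) ** transpose U'"
    unfolding W_def by (metis U(1) U'(1) matrix_mul_assoc matrix_mul_lid matrix_mul_rid)
  then show ?thesis
    unfolding reg_inverse_def c
    by (simp add: reg_inverse_wrt_eq[OF e psd \<open>c > 0\<close>] reg_inverse_wrt_eq[OF e' psd \<open>c > 0\<close>] f_def)
qed


section \<open>Locally linear embedding\<close>

text \<open>In what follows \<open>\<Omega>\<close> is the probability space on which the random vector \<open>X\<close> lives,
  and \<open>z\<close> is the base point \<open>\<iota>(x)\<close>.\<close>

definition local_cov ::
  "'w measure \<Rightarrow> ('w \<Rightarrow> ('p::finite) rvec) \<Rightarrow> real \<Rightarrow> 'p rvec \<Rightarrow> 'p rmat" where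
  "local_cov \<Omega> X \<epsilon> z =
     (\<integral>\<omega>. indicator (cball z \<epsilon>) (X \<omega>) *\<^sub>R
        ((columnvector (X \<omega> - z) :: real^1^'p) ** rowvector (X \<omega> - z)) \<partial>\<Omega>)"

definition local_mean ::
  "'w measure \<Rightarrow> ('w \<Rightarrow> ('p::finite) rvec) \<Rightarrow> real \<Rightarrow> 'p rvec \<Rightarrow> 'p rvec" where
  "local_mean \<Omega> X \<epsilon> z = (\<integral>\<omega>. indicator (cball z \<epsilon>) (X \<omega>) *\<^sub>R (X \<omega> - z) \<partial>\<Omega>)"

definition T_vec ::
  "'w measure \<Rightarrow> ('w \<Rightarrow> ('p::{finite,linorder}) rvec) \<Rightarrow> real \<Rightarrow> nat \<Rightarrow> real \<Rightarrow> 'p rvec \<Rightarrow> 'p rvec" where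
  "T_vec \<Omega> X \<epsilon> d \<rho> z =
     reg_inverse (\<epsilon> powr (real d + \<rho>)) (local_cov \<Omega> X \<epsilon> z) *v local_mean \<Omega> X \<epsilon> z"

definition LLE_integrand ::
  "'w measure \<Rightarrow> ('w \<Rightarrow> ('p::{finite,linorder}) rvec) \<Rightarrow> real \<Rightarrow> nat \<Rightarrow> real \<Rightarrow>
    ('p rvec \<Rightarrow> real) \<Rightarrow> 'p rvec \<Rightarrow> 'w \<Rightarrow> real" where
  "LLE_integrand \<Omega> X \<epsilon> d \<rho> f z \<omega> =
     f (X \<omega>) * (1 - T_vec \<Omega> X \<epsilon> d \<rho> z \<bullet> (X \<omega> - z)) * indicator (cball z \<epsilon>) (X \<omega>)"

definition K_LLE ::
  "'w measure \<Rightarrow> ('w \<Rightarrow> ('p::{finite,linorder}) rvec) \<Rightarrow> real \<Rightarrow> nat \<Rightarrow> real \<Rightarrow>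
    'm set \<Rightarrow> ('m \<Rightarrow> 'p rvec) \<Rightarrow> 'm \<Rightarrow> 'm \<Rightarrow> real" where
  "K_LLE \<Omega> X \<epsilon> d \<rho> M \<iota> x y =
     (1 - T_vec \<Omega> X \<epsilon> d \<rho> (\<iota> x) \<bullet> (\<iota> y - \<iota> x)) * indicator (cball (\<iota> x) \<epsilon> \<inter> \<iota> ` M) (\<iota> y)"

end

theory Submission
  imports Defs
begin

text \<open>
  The law of \<open>X\<close> is \<open>P\<close> times the pushforward of the Riemannian volume under \<open>\<iota>\<close>, so the identity is
  the change of variables formula. Integrability holds because the integrand is continuous on the
  compact set \<open>\<iota>(M)\<close> up to the indicator of a ball, hence bounded.
\<close>

text \<open>\<open>riemannian_volume\<close> prescribes \<open>sets V\<close> but says nothing of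
  \<open>space V\<close>. The carrier is recovered because two measures with the same measurable
  sets have the same space, here compared with the sigma-algebra generated by the open sets of
  \<open>T\<close>.\<close>

lemma space_riemannian_volume:
  assumes "riemannian_volume T \<A> g V"
  shows "space V = topspace T"
proof -
  have sets: "sets V = sigma_sets (topspace T) {U. openin T U}"
    using assms by (simp add: riemannian_volume_def)
  have sub: "{U. openin T U} \<subseteq> Pow (topspace T)"
    using openin_subset by auto
  have "sets V = sets (sigma (topspace T) {U. openin T U})"
    using sub by (simp add: sets)
  then have "space V = space (sigma (topspace T) {U. openin T U})"
    by (rule sets_eq_imp_space_eq)
  then show ?thesis
    using sub by (simp add: space_measure_of)
qed

text \<open>The preimage of an open set is open in \<open>T\<close>, hence one of the generators of
  \<open>sets V\<close>. This makes \<iota> a measurable map although \<open>T\<close> is an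
  explicit topology and not that of a type class.\<close>

lemma continuous_map_measurable_riemannian_volume:
  fixes h :: "'m \<Rightarrow> 'a::topological_space"
  assumes V: "riemannian_volume T \<A> g V" and h: "continuous_map T euclidean h"
  shows "h \<in> borel_measurable V"
proof (rule borel_measurableI)
  fix W :: "'a set" assume "open W"
  then have "openin T {x \<in> topspace T. h x \<in> W}"
    using h by (simp add: openin_continuous_map_preimage)
  moreover have "h -` W \<inter> space V = {x \<in> topspace T. h x \<in> W}"
    using space_riemannian_volume[OF V] by auto
  ultimately show "h -` W \<inter> space V \<in> sets V"
    using V by (auto simp: riemannian_volume_def intro: sigma_sets.Basic)
qed

text \<open>Two changes of variables in a row: \<open>X\<close> carries the expectation to an
  integral against \<open>P\<close> times the pushforward measure, and \<phi> pulls that integral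
  back to \<open>V\<close>. Integrability passes along the same two steps.\<close>

lemma distributed_distr_integral:
  fixes P h :: "'b \<Rightarrow> real"
  assumes X: "distributed \<Omega> (distr V N \<phi>) X (\<lambda>z. ennreal (P z))"
    and [measurable]: "\<phi> \<in> V \<rightarrow>\<^sub>M N" "h \<in> borel_measurable N"
    and P: "\<And>z. z \<in> space N \<Longrightarrow> 0 \<le> P z"
    and int: "integrable \<Omega> (\<lambda>\<omega>. h (X \<omega>))"
  shows "integrable V (\<lambda>y. P (\<phi> y) * h (\<phi> y))"
    and "(\<integral>y. P (\<phi> y) * h (\<phi> y) \<partial>V) = (\<integral>\<omega>. h (X \<omega>) \<partial>\<Omega>)"
proof -
  have P': "\<And>z. z \<in> space (distr V N \<phi>) \<Longrightarrow> 0 \<le> P z"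
    using P by simp
  \<comment> \<open>\<open>distributed\<close> only makes \<open>ennreal (P z)\<close> measurable;
    since \<open>P\<close> is nonnegative on the space, no value is truncated and the real function
    is measurable too.\<close>
  have [measurable]: "P \<in> borel_measurable N"
    using distributed_real_measurable[OF P' X] by simp
  have h: "h \<in> borel_measurable (distr V N \<phi>)"
    by simp
  have "integrable (distr V N \<phi>) (\<lambda>z. P z * h z)"
    using distributed_integrable[OF X h P'] int by simp
  then show "integrable V (\<lambda>y. P (\<phi> y) * h (\<phi> y))"
    by (simp add: integrable_distr_eq)
  have "(\<integral>z. P z * h z \<partial>distr V N \<phi>) = (\<integral>\<omega>. h (X \<omega>) \<partial>\<Omega>)"
    by (rule distributed_integral[OF X h P'])
  then show "(\<integral>y. P (\<phi> y) * h (\<phi> y) \<partial>V) = (\<integral>\<omega>. h (X \<omega>) \<partial>\<Omega>)"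
    by (simp add: integral_distr)
qed

theorem corollary3p1:
  fixes T :: "'m topology"
    and \<A> :: "('m, 'd::finite) chart set"
    and g :: "('m, 'd) chart \<Rightarrow> 'm \<Rightarrow> real^'d^'d"
    and V :: "'m measure"
    and \<iota> :: "'m \<Rightarrow> ('p::{finite,linorder}) rvec"
    and \<Omega> :: "'w measure"
    and X :: "'w \<Rightarrow> 'p rvec"
    and P :: "'p rvec \<Rightarrow> real"
    and P\<^sub>m P\<^sub>M \<epsilon> \<rho> :: real
  assumes "smooth_manifold T \<A>" and "compact_space T"
    and "riemannian_metric \<A> g"
    and "riemannian_volume T \<A> g V"
    and "isometric_embedding T \<A> g \<iota>"
    and "prob_space \<Omega>"
    and "X \<in> borel_measurable \<Omega>" and "X ` space \<Omega> \<subseteq> \<iota> ` topspace T"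
    and "distributed \<Omega> (induced_volume V \<iota>) X (\<lambda>z. ennreal (P z))"
    and "Ck_on_image 5 \<A> \<iota> P"
    and "0 < P\<^sub>m" and "\<forall>z\<in>\<iota> ` topspace T. P\<^sub>m \<le> P z \<and> P z \<le> P\<^sub>M"
    and "\<epsilon> > 0"
  shows "\<forall>f. continuous_on (\<iota> ` topspace T) f \<longrightarrow> (\<forall>x\<in>topspace T.
     integrable \<Omega> (LLE_integrand \<Omega> X \<epsilon> CARD('d) \<rho> f (\<iota> x)) \<and>
     integrable V (\<lambda>y. K_LLE \<Omega> X \<epsilon> CARD('d) \<rho> (topspace T) \<iota> x y * f (\<iota> y) * P (\<iota> y)) \<and>
     (\<integral>\<omega>. LLE_integrand \<Omega> X \<epsilon> CARD('d) \<rho> f (\<iota> x) \<omega> \<partial>\<Omega>) =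
     (\<integral>y. K_LLE \<Omega> X \<epsilon> CARD('d) \<rho> (topspace T) \<iota> x y * f (\<iota> y) * P (\<iota> y) \<partial>V))"
proof (intro allI impI ballI)
  fix f :: "'p rvec \<Rightarrow> real" and x
  assume f: "continuous_on (\<iota> ` topspace T) f" and "x \<in> topspace T"
  note V = \<open>riemannian_volume T \<A> g V\<close>
  let ?S = "\<iota> ` topspace T"
  \<comment> \<open>\<open>f\<close> and \<open>P\<close> are controlled only on \<iota>(M), so
    measurability is always taken with respect to the Borel sets of that image.\<close>
  let ?N = "restrict_space borel ?S :: 'p rvec measure"
  let ?w = "\<lambda>z. f z * (1 - T_vec \<Omega> X \<epsilon> CARD('d) \<rho> (\<iota> x) \<bullet> (z - \<iota> x))"
  let ?h = "\<lambda>z. ?w z * indicator (cball (\<iota> x) \<epsilon>) z"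
  interpret prob_space \<Omega> by fact

  have "embedding_map T euclidean \<iota>"
    using \<open>isometric_embedding T \<A> g \<iota>\<close> by (simp add: isometric_embedding_def)
  then have \<iota>: "continuous_map T euclidean \<iota>"
    unfolding embedding_map_def by (metis homeomorphic_imp_continuous_map continuous_map_in_subtopology)
  have "compactin euclidean ?S"
    using \<open>compact_space T\<close> \<iota> unfolding compact_space_def by (rule image_compactin)
  then have "compact ?S" by simp
  have space_V: "space V = topspace T"
    using V by (rule space_riemannian_volume)
  have \<iota>_meas: "\<iota> \<in> V \<rightarrow>\<^sub>M ?N"
    using continuous_map_measurable_riemannian_volume[OF V \<iota>]
    by (intro measurable_restrict_space2) (auto simp: space_V)
  have X_meas: "X \<in> \<Omega> \<rightarrow>\<^sub>M ?N"
    using assms(7,8) by (intro measurable_restrict_space2) auto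
  \<comment> \<open>The vector \<open>T_vec\<close> depends on the base point
    \<open>\<iota> x\<close> and not on \<open>z\<close>, so the second factor is affine in
    \<open>z\<close>.\<close>
  have w: "continuous_on ?S ?w"
    using f by (intro continuous_intros)
  have "?w \<in> borel_measurable ?N"
    using w by (rule borel_measurable_continuous_on_restrict)
  moreover have "(indicator (cball (\<iota> x) \<epsilon>) :: _ \<Rightarrow> real) \<in> borel_measurable ?N"
    by (intro measurable_restrict_space1 borel_measurable_indicator borel_closed closed_cball)
  ultimately have h_meas: "?h \<in> borel_measurable ?N"
    by (rule borel_measurable_times)

  have "bounded (?w ` ?S)"
    using compact_continuous_image[OF w \<open>compact ?S\<close>] by (rule compact_imp_bounded)
  then obtain B where B: "\<And>z. z \<in> ?S \<Longrightarrow> \<bar>?w z\<bar> \<le> B"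
    by (force simp: bounded_iff)
  have h_int: "integrable \<Omega> (\<lambda>\<omega>. ?h (X \<omega>))"
  \<comment> \<open>On a probability space a bounded measurable function is integrable; the
    indicator can only decrease the absolute value of \<open>?w\<close>.\<close>
  proof (rule integrable_const_bound)
    have "norm (?h (X \<omega>)) \<le> B" if "\<omega> \<in> space \<Omega>" for \<omega>
    proof -
      have "X \<omega> \<in> ?S"
        using that assms(8) by blast
      have "norm (?h (X \<omega>)) \<le> \<bar>?w (X \<omega>)\<bar>"
        by (simp add: indicator_def)
      also have "\<dots> \<le> B"
        using \<open>X \<omega> \<in> ?S\<close> by (rule B)
      finally show ?thesis .
    qed
    then show "AE \<omega> in \<Omega>. norm (?h (X \<omega>)) \<le> B"
      by (rule AE_I2)
    show "(\<lambda>\<omega>. ?h (X \<omega>)) \<in> borel_measurable \<Omega>"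
      using X_meas h_meas by (rule measurable_compose)
  qed

  have X: "distributed \<Omega> (distr V ?N \<iota>) X (\<lambda>z. ennreal (P z))"
    using assms(9) by (simp add: induced_volume_def space_V)
  have P: "0 \<le> P z" if "z \<in> space ?N" for z
    using that assms(11,12) by (force simp: space_restrict_space)
  \<comment> \<open>The kernel cuts off to the ball intersected with \<iota>(M), whereas
    \<open>?h\<close> cuts off to the ball alone. The two agree at \<open>\<iota> y\<close>, which
    lies in \<iota>(M).\<close>
  have K: "K_LLE \<Omega> X \<epsilon> CARD('d) \<rho> (topspace T) \<iota> x y * f (\<iota> y) * P (\<iota> y) = P (\<iota> y) * ?h (\<iota> y)"
    if "y \<in> space V" for y
    using that by (simp add: K_LLE_def space_V indicator_def)
  note LOTUS = distributed_distr_integral[OF X \<iota>_meas h_meas P h_int]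
  show "integrable \<Omega> (LLE_integrand \<Omega> X \<epsilon> CARD('d) \<rho> f (\<iota> x)) \<and>
     integrable V (\<lambda>y. K_LLE \<Omega> X \<epsilon> CARD('d) \<rho> (topspace T) \<iota> x y * f (\<iota> y) * P (\<iota> y)) \<and>
     (\<integral>\<omega>. LLE_integrand \<Omega> X \<epsilon> CARD('d) \<rho> f (\<iota> x) \<omega> \<partial>\<Omega>) =
     (\<integral>y. K_LLE \<Omega> X \<epsilon> CARD('d) \<rho> (topspace T) \<iota> x y * f (\<iota> y) * P (\<iota> y) \<partial>V)"
    using h_int LOTUS
    by (simp add: LLE_integrand_def[abs_def] K cong: Bochner_Integration.integrable_cong
        Bochner_Integration.integral_cong)
qed

end
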